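(* Let $A$ be a finite alphabet with $\#(A)\ge 2$. If $\mathcal C\subseteq\mathsf G_A$ is a local variety (of group languages) over $A$, then $\mathrm{RExt}(\mathcal C)\cap\mathsf G_A=\mathcal C$. In particular, if $\mathcal C\subsetneq\mathcal D\subseteq\mathsf G_A$ are local varieties over $A$, then $\mathrm{RExt}(\mathcal C)\cap\mathcal D=\mathcal C$, $\mathcal D\not\subseteq\mathrm{RExt}(\mathcal C)$, and $\mathrm{RExt}(\mathcal C)\subsetneq\mathrm{RExt}(\mathcal D)$.
   Context: $\#(X)$ denotes the cardinality of a set $X$. For $L\subseteq A^*$, the density is $\delta_A(L)=\lim_{n\to\infty}\frac1n\sum_{k=0}^{n-1}\frac{\#(L\cap A^k)}{\#(A^k)}$ if the limit exists, otherwise $\delta_A(L)=\bot$ (undefined). (Every regular language has a density.) For a family $\mathcal C$ of languages over $A$ and $L\subseteq A^*$, put $\underline{\mu}_{\mathcal C}(L)=\sup\{\delta_A(K): K\subseteq L,\ K\in\mathcal C,\ \delta_A(K)\ne\bot\}$ and $\overline{\mu}_{\mathcal C}(L)=\inf\{\delta_A(K): L\subseteq K,\ K\in\mathcal C,\ \delta_A(K)\ne\bot\}$. $L$ is $\mathcal C$-measurable if $\underline{\mu}_{\mathcal C}(L)=\overline{\mu}_{\mathcal C}(L)$. $\mathrm{RExt}(\mathcal C)$ is the class of all $\mathcal C$-measurable regular languages over $A$. $\mathsf G_A$ is the class of group languages over $A$: languages $L\subseteq A^*$ such that $L=\eta^{-1}(S)$ for some monoid morphism $\eta:A^*\to G$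 to a finite group $G$ and some $S\subseteq G$. A local variety over $A$ is a family of regular languages over $A$ closed under Boolean operations (finite unions, finite intersections, including the empty ones, so that $\varnothing$ and $A^*$ belong to it, and complements in $A^*$) and under left and right quotients ($u^{-1}L=\{w: uw\in L\}$ and $Lv^{-1}=\{w: wv\in L\}$ for $u,v\in A^*$). *)

theory Defs
  imports Complex_Main "HOL-Library.Cardinality" "HOL-Algebra.Group"
begin

(* The alphabet A is the finite type 'a: A* is the type 'a list, #(A) is CARD('a), and languages
   over A are elements of 'a list set. *)

definition words :: "nat \<Rightarrow> 'a list set" where
  "words k = {w. length w = k}"

definition density_mean :: "'a list set \<Rightarrow> nat \<Rightarrow> real" where
  "density_mean L n =
     1 / real n * (\<Sum>k<n. real (card (L \<inter> words k)) / real (card (words k :: 'a list set)))"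

(* None is the undefined value. *)
definition lang_density :: "'a list set \<Rightarrow> real option" where
  "lang_density L =
     (if convergent (density_mean L) then Some (lim (density_mean L)) else None)"

(* Sup and Inf are those of real, hence unspecified on the empty set. This is harmless when the
   family contains {} and UNIV (as any local variety does): then both sets below are nonempty,
   and they lie in {0..1}; see lang_density_bounds, lang_density_empty, lang_density_UNIV. *)
definition lower_measure :: "'a list set set \<Rightarrow> 'a list set \<Rightarrow> real" where
  "lower_measure C L = Sup {d. \<exists>K\<in>C. K \<subseteq> L \<and> lang_density K = Some d}"

definition upper_measure :: "'a list set set \<Rightarrow> 'a list set \<Rightarrow> real" where
  "upper_measure C L = Inf {d. \<exists>K\<in>C. L \<subseteq> K \<and> lang_density K = Some d}"

definition lang_measurable :: "'a list set set \<Rightarrow> 'a list set \<Rightarrow> bool" where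
  "lang_measurable C L \<longleftrightarrow> lower_measure C L = upper_measure C L"

(* Acceptance by a complete deterministic finite automaton. Taking the states in nat loses no
   generality; see regular_langI. *)
definition regular_lang :: "'a list set \<Rightarrow> bool" where
  "regular_lang L \<longleftrightarrow>
     (\<exists>(Q :: nat set) \<delta> q0 F. finite Q \<and> q0 \<in> Q \<and> F \<subseteq> Q \<and> (\<forall>q\<in>Q. \<forall>a. \<delta> q a \<in> Q) \<and>
        L = {w. foldl \<delta> q0 w \<in> F})"

definition RExt :: "'a list set set \<Rightarrow> 'a list set set" where
  "RExt C = {L. regular_lang L \<and> lang_measurable C L}"

definition free_monoid :: "'a list monoid" where
  "free_monoid = \<lparr>carrier = UNIV, mult = (@), one = []\<rparr>"

definition monoid_morphisms :: "('a, 'c) monoid_scheme \<Rightarrow> ('b, 'd) monoid_scheme \<Rightarrow> ('a \<Rightarrow> 'b) set" where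
  "monoid_morphisms M N = {h \<in> hom M N. h \<one>\<^bsub>M\<^esub> = \<one>\<^bsub>N\<^esub>}"

(* Taking the group elements in nat loses no generality; see group_langsI. *)
definition group_langs :: "'a list set set" where
  "group_langs =
     {L. \<exists>(G :: nat monoid) \<eta> S. group G \<and> finite (carrier G) \<and>
           \<eta> \<in> monoid_morphisms free_monoid G \<and> S \<subseteq> carrier G \<and> L = \<eta> -` S}"

definition left_quotient :: "'a list \<Rightarrow> 'a list set \<Rightarrow> 'a list set" where
  "left_quotient u L = {w. u @ w \<in> L}"

definition right_quotient :: "'a list set \<Rightarrow> 'a list \<Rightarrow> 'a list set" where
  "right_quotient L v = {w. w @ v \<in> L}"

definition local_variety :: "'a list set set \<Rightarrow> bool" where
  "local_variety C \<longleftrightarrow>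
     (\<forall>L\<in>C. regular_lang L) \<and>
     {} \<in> C \<and> UNIV \<in> C \<and>
     (\<forall>K\<in>C. \<forall>L\<in>C. K \<union> L \<in> C) \<and>
     (\<forall>K\<in>C. \<forall>L\<in>C. K \<inter> L \<in> C) \<and>
     (\<forall>L\<in>C. - L \<in> C) \<and>
     (\<forall>L\<in>C. \<forall>u. left_quotient u L \<in> C) \<and>
     (\<forall>L\<in>C. \<forall>v. right_quotient L v \<in> C)"

lemma regular_langI:
  fixes Q :: "'q set"
  assumes "finite Q" "q0 \<in> Q" "F \<subseteq> Q" and step: "\<And>q a. q \<in> Q \<Longrightarrow> \<delta> q a \<in> Q"
  shows "regular_lang {w. foldl \<delta> q0 w \<in> F}"
proof -
  obtain f :: "'q \<Rightarrow> nat" where f: "inj_on f Q"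
    using finite_imp_inj_to_nat_seg[OF \<open>finite Q\<close>] by blast
  define \<delta>' where "\<delta>' = (\<lambda>n a. f (\<delta> (inv_into Q f n) a))"
  have run: "q \<in> Q \<Longrightarrow> foldl \<delta> q w \<in> Q \<and> foldl \<delta>' (f q) w = f (foldl \<delta> q w)" for w q
    by (induction w arbitrary: q) (auto simp: \<delta>'_def f step)
  have "{w. foldl \<delta> q0 w \<in> F} = {w. foldl \<delta>' (f q0) w \<in> f ` F}"
    using run[OF assms(2)] inj_on_image_mem_iff[OF f _ \<open>F \<subseteq> Q\<close>] by auto
  moreover have "\<forall>n\<in>f ` Q. \<forall>a. \<delta>' n a \<in> f ` Q"
    by (auto simp: \<delta>'_def f step)
  ultimately show ?thesis
    unfolding regular_lang_def using assms
    by (intro exI[of _ "f ` Q"] exI[of _ \<delta>'] exI[of _ "f q0"] exI[of _ "f ` F"]) auto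
qed

lemma group_langsI:
  fixes G :: "('g, 'm) monoid_scheme"
  assumes G: "group G" and fin: "finite (carrier G)"
    and \<eta>: "\<eta> \<in> monoid_morphisms free_monoid G" and S: "S \<subseteq> carrier G"
  shows "\<eta> -` S \<in> group_langs"
proof -
  interpret group G by fact
  obtain f :: "'g \<Rightarrow> nat" where f: "inj_on f (carrier G)"
    using finite_imp_inj_to_nat_seg[OF fin] by blast
  define g where "g = inv_into (carrier G) f"
  define H :: "nat monoid" where
    "H = \<lparr>carrier = f ` carrier G, mult = (\<lambda>x y. f (g x \<otimes>\<^bsub>G\<^esub> g y)), one = f \<one>\<^bsub>G\<^esub>\<rparr>"
  have gf[simp]: "x \<in> carrier G \<Longrightarrow> g (f x) = x" for x
    by (simp add: g_def f)
  have mem: "\<eta> w \<in> carrier G" for w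
    using \<eta> by (auto simp: monoid_morphisms_def hom_def free_monoid_def)
  have "group H"
  proof (rule groupI)
    fix x assume "x \<in> carrier H"
    then obtain y where "y \<in> carrier G" "x = f y" by (auto simp: H_def)
    then show "\<exists>z\<in>carrier H. z \<otimes>\<^bsub>H\<^esub> x = \<one>\<^bsub>H\<^esub>"
      by (intro bexI[of _ "f (inv\<^bsub>G\<^esub> y)"]) (auto simp: H_def)
  qed (auto simp: H_def m_assoc)
  moreover have "finite (carrier H)"
    by (simp add: H_def fin)
  moreover have "f \<circ> \<eta> \<in> monoid_morphisms free_monoid H"
    using \<eta> mem by (auto simp: monoid_morphisms_def hom_def free_monoid_def H_def)
  moreover have "f ` S \<subseteq> carrier H"
    using S by (auto simp: H_def)
  moreover have "\<eta> -` S = (f \<circ> \<eta>) -` (f ` S)"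
    by (rule Set.set_eqI) (simp only: vimage_eq o_apply inj_on_image_mem_iff[OF f mem S])
  ultimately show ?thesis
    unfolding group_langs_def by blast
qed

lemma words_finite: "finite (words k :: 'a::finite list set)"
  unfolding words_def using finite_lists_length_eq[of "UNIV :: 'a set" k] by simp

lemma words_card_pos: "card (words k :: 'a::finite list set) > 0"
  using words_finite[of k] Ex_list_of_length[of k] by (auto simp: card_gt_0_iff words_def)

lemma density_mean_bounds:
  fixes L :: "'a::finite list set"
  shows "density_mean L n \<in> {0..1}"
proof -
  have "card (L \<inter> words k) \<le> card (words k :: 'a list set)" for k
    by (rule card_mono) (auto simp: words_finite)
  then have "real (card (L \<inter> words k)) / real (card (words k :: 'a list set)) \<le> 1" for k
    using words_card_pos[where 'a='a, of k] by simp
  then have "(\<Sum>k<n. real (card (L \<inter> words k)) / real (card (words k :: 'a list set))) \<le> real n"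
    using sum_bounded_above[of "{..<n}" _ "1 :: real"] by simp
  then show ?thesis
    by (auto simp: density_mean_def sum_nonneg divide_simps)
qed

lemma lang_density_bounds:
  fixes L :: "'a::finite list set"
  assumes "lang_density L = Some d"
  shows "d \<in> {0..1}"
proof -
  have "density_mean L \<longlonglongrightarrow> d"
    using assms by (auto simp: lang_density_def convergent_LIMSEQ_iff split: if_splits)
  then show ?thesis
    by (rule closed_sequentially[rotated -1]) (use density_mean_bounds in auto)
qed

lemma lang_density_empty: "lang_density ({} :: 'a::finite list set) = Some 0"
proof -
  have "density_mean ({} :: 'a list set) = (\<lambda>n. 0)"
    by (simp add: density_mean_def fun_eq_iff)
  then show ?thesis by (simp add: lang_density_def convergent_const)
qed

lemma lang_density_UNIV: "lang_density (UNIV :: 'a::finite list set) = Some 1"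
proof -
  have "\<forall>\<^sub>F n in sequentially. density_mean (UNIV :: 'a list set) n = 1"
    using eventually_gt_at_top[of 0]
    by eventually_elim (use words_card_pos[where 'a='a] in \<open>simp add: density_mean_def less_imp_neq[symmetric]\<close>)
  then have "density_mean (UNIV :: 'a list set) \<longlonglongrightarrow> 1"
    by (rule tendsto_eventually)
  then show ?thesis by (auto simp: lang_density_def limI convergent_def)
qed

end

(* Let L be recognised by a morphism eta to a finite group, and let K be a member of C contained
   in L. The union of the quotients of K by the words in the kernel of eta is again in C, lies
   between K and L, and is saturated by eta, because words have common inverses modulo any two
   finite groups. There are finitely many eta-saturated languages, so L has a largest subset in C,
   and dually a smallest superset in C. If L is C-measurable, then these two differ by a group
   language of density 0. The random walk on a finite group equidistributes in the mean over the
   subgroup that it generates, so that group language is empty. *)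

theory Submission
  imports Defs "HOL-Library.Disjoint_Sets" "HOL-Algebra.Multiplicative_Group"
begin

section \<open>Density of group languages\<close>

lemma words_Suc: "words (Suc k) = (\<Union>x. (\<lambda>w. w @ [x]) ` words k)"
proof -
  have "w \<in> (\<Union>x. (\<lambda>w. w @ [x]) ` words k)" if "length w = Suc k" for w :: "'a list"
  proof -
    have "w = butlast w @ [last w]" using that by (metis append_butlast_last_id list.size(3) nat.distinct(1))
    moreover have "butlast w \<in> words k" using that by (simp add: words_def)
    ultimately show ?thesis by blast
  qed
  then show ?thesis by (auto simp: words_def)
qed

lemma card_words: "card (words k :: 'a::finite list set) = CARD('a) ^ k"
  using card_lists_length_eq[of "UNIV :: 'a set" k] by (simp add: words_def)

lemma card_Int_words_Suc:
  fixes L :: "'a::finite list set"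
  shows "card (L \<inter> words (Suc k)) = (\<Sum>x\<in>UNIV. card (right_quotient L [x] \<inter> words k))"
proof -
  have "L \<inter> words (Suc k) = (\<Union>x. (\<lambda>w. w @ [x]) ` (right_quotient L [x] \<inter> words k))"
    by (auto simp: words_Suc right_quotient_def)
  also have "card \<dots> = (\<Sum>x\<in>UNIV. card ((\<lambda>w. w @ [x]) ` (right_quotient L [x] \<inter> words k)))"
    by (rule card_UN_disjoint) (auto simp: words_finite)
  also have "\<dots> = (\<Sum>x\<in>UNIV. card (right_quotient L [x] \<inter> words k))"
    by (intro sum.cong refl card_image inj_onI) auto
  finally show ?thesis .
qed

lemma density_mean_mono:
  fixes K L :: "'a::finite list set"
  assumes "K \<subseteq> L"
  shows "density_mean K n \<le> density_mean L n"
  unfolding density_mean_def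
  by (intro mult_left_mono sum_mono divide_right_mono)
    (use assms in \<open>auto intro!: card_mono simp: words_finite\<close>)

lemma density_mean_UN:
  fixes L :: "'i \<Rightarrow> 'a::finite list set"
  assumes "finite I" "disjoint_family_on L I"
  shows "density_mean (\<Union>i\<in>I. L i) n = (\<Sum>i\<in>I. density_mean (L i) n)"
proof -
  have "card ((\<Union>i\<in>I. L i) \<inter> words k) = (\<Sum>i\<in>I. card (L i \<inter> words k))" for k
    unfolding Int_UN_distrib2 UN_simps(4)[symmetric]
    by (subst card_UN_disjoint[symmetric])
      (use assms in \<open>auto simp: words_finite disjoint_family_on_def\<close>)
  then show ?thesis
    unfolding density_mean_def
    by (simp add: sum_divide_distrib sum_distrib_left sum.swap[of _ I])
qed

lemma density_mean_UNIV:
  "n > 0 \<Longrightarrow> density_mean (UNIV :: 'a::finite list set) n = 1"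
  by (simp add: density_mean_def words_card_pos[THEN less_imp_neq, symmetric])

text \<open>Deleting the last letter turns the proportion in length k + 1 into the average over x of
  the proportions of \<open>right_quotient L [x]\<close> in length k. Re-indexing the sum over k < n
  costs at most 1, hence the error 1 / n.\<close>

lemma density_mean_right_quotients:
  fixes L :: "'a::finite list set"
  assumes "n > 0"
  shows "density_mean L n \<le> (\<Sum>x\<in>UNIV. density_mean (right_quotient L [x]) n) / CARD('a) + 1 / n"
proof -
  define a where "a K k = real (card (K \<inter> words k)) / real (card (words k :: 'a list set))"
    for K :: "'a list set" and k
  have mean: "density_mean K n = (\<Sum>k<n. a K k) / n" for K
    by (simp add: density_mean_def a_def)
  have a_Suc: "a L (Suc k) = (\<Sum>x\<in>UNIV. a (right_quotient L [x]) k) / CARD('a)" for k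
    by (simp add: a_def card_Int_words_Suc card_words sum_divide_distrib mult.commute)
  have "a L 0 \<le> 1"
    using card_mono[OF words_finite[of 0], of "L \<inter> words 0"] words_card_pos[where 'a='a, of 0]
    by (auto simp: a_def)
  moreover have "a L n \<ge> 0" by (simp add: a_def)
  \<comment> \<open>The shift trades the term at length 0 for the term at length n: the former is at
    most 1, the latter is dropped as nonnegative.\<close>
  moreover have "(\<Sum>k<n. a L k) + a L n = a L 0 + (\<Sum>k<n. a L (Suc k))"
    using sum.lessThan_Suc_shift[of "a L" n] by simp
  ultimately have "(\<Sum>k<n. a L k) \<le> (\<Sum>k<n. a L (Suc k)) + 1" by linarith
  then have "(\<Sum>k<n. a L k) / n \<le> ((\<Sum>k<n. a L (Suc k)) + 1) / n"
    using assms by (simp add: divide_right_mono)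
  also have "(\<Sum>k<n. a L (Suc k)) =
      (\<Sum>x\<in>UNIV. \<Sum>k<n. a (right_quotient L [x]) k) / CARD('a)"
    by (simp add: a_Suc sum_divide_distrib sum.swap[of _ UNIV])
  finally show ?thesis
    by (simp add: mean add_divide_distrib sum_divide_distrib[symmetric] mult.commute)
qed

section \<open>Morphisms to finite groups: inverse words and quotients of fibres\<close>

locale finite_group_morphism = group G for G :: "('b, 'm) monoid_scheme" (structure) +
  fixes \<eta> :: "'a list \<Rightarrow> 'b"
  assumes finite_carrier: "finite (carrier G)"
    and morphism: "\<eta> \<in> monoid_morphisms free_monoid G"
begin

lemma \<eta>_closed [simp]: "\<eta> w \<in> carrier G"
  and \<eta>_append [simp]: "\<eta> (u @ v) = \<eta> u \<otimes> \<eta> v"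
  and \<eta>_Nil [simp]: "\<eta> [] = \<one>"
  using morphism by (auto simp: monoid_morphisms_def hom_def free_monoid_def)

lemma \<eta>_concat_replicate: "\<eta> (concat (replicate k w)) = \<eta> w [^] k"
  by (induction k) (simp_all flip: nat_pow_Suc2)

lemma finite_range: "finite (range \<eta>)"
  by (rule finite_subset[OF _ finite_carrier]) auto

lemma order_pos: "order G > 0"
  by (simp add: order_gt_0_iff_finite finite_carrier)

lemma pow_multiple_order: "\<eta> w [^] (order G * k) = \<one>"
  by (simp add: pow_order_eq_1 flip: nat_pow_pow)

end

text \<open>Finite order replaces inversion: if m is the product of both group orders, then w^m maps
  to the identity in both groups, so w^(m - 1) inverts w on both sides at once.\<close>

lemma common_inverse_word:
  assumes "finite_group_morphism G \<eta>" "finite_group_morphism H \<phi>"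
  obtains v where "\<eta> (v @ w) = \<one>\<^bsub>G\<^esub>" "\<phi> (v @ w) = \<one>\<^bsub>H\<^esub>"
    "\<eta> (w @ v) = \<one>\<^bsub>G\<^esub>" "\<phi> (w @ v) = \<one>\<^bsub>H\<^esub>"
proof -
  interpret G: finite_group_morphism G \<eta> by fact
  interpret H: finite_group_morphism H \<phi> by fact
  define m where "m = order G * order H"
  obtain k where k: "m = Suc k"
    using G.order_pos H.order_pos unfolding m_def by (metis nat_0_less_mult_iff not0_implies_Suc less_irrefl)
  define v where "v = concat (replicate k w)"
  have wv: "w @ v = concat (replicate m w)" by (simp add: k v_def)
  have "v @ w = concat (replicate k w @ [w])" by (simp add: v_def)
  then have vw: "v @ w = concat (replicate m w)" by (simp only: replicate_append_same k replicate_Suc)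
  have "\<eta> (concat (replicate m w)) = \<one>\<^bsub>G\<^esub>"
    unfolding G.\<eta>_concat_replicate m_def by (rule G.pow_multiple_order)
  moreover have "\<phi> (concat (replicate m w)) = \<one>\<^bsub>H\<^esub>"
    unfolding H.\<eta>_concat_replicate m_def by (subst mult.commute) (rule H.pow_multiple_order)
  ultimately show ?thesis
    using that wv vw by metis
qed

text \<open>Cancellation in the group forces all words of the quotient to have the same image. The
  quotient is empty when \<open>g\<close> is outside the image of \<eta>, which need not be
  surjective.\<close>

lemma (in finite_group_morphism) right_quotient_fibre:
  "right_quotient (\<eta> -` {g}) v = {} \<or> (\<exists>h\<in>range \<eta>. right_quotient (\<eta> -` {g}) v = \<eta> -` {h})"
proof (cases "right_quotient (\<eta> -` {g}) v = {}")
  case False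
  then obtain u where "\<eta> u \<otimes> \<eta> v = g" by (auto simp: right_quotient_def)
  then have "right_quotient (\<eta> -` {g}) v = \<eta> -` {\<eta> u}"
    by (auto simp: right_quotient_def)
  then show ?thesis by auto
qed simp

lemma (in finite_group_morphism) right_quotient_fibre_mult:
  "h \<in> carrier G \<Longrightarrow> right_quotient (\<eta> -` {h \<otimes> \<eta> v}) v = \<eta> -` {h}"
  by (auto simp: right_quotient_def)

section \<open>Equidistribution in the mean over the image of the morphism\<close>

locale equidistribution = finite_group_morphism G \<eta>
  for G :: "('b, 'm) monoid_scheme" (structure) and \<eta> :: "'a::finite list \<Rightarrow> 'b"
begin

definition freq :: "nat \<Rightarrow> 'b \<Rightarrow> real" where
  "freq n g = density_mean (\<eta> -` {g}) n"

definition max_freq :: "nat \<Rightarrow> real" where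
  "max_freq n = Max (freq n ` range \<eta>)"

lemma freq_le_max_freq: "g \<in> range \<eta> \<Longrightarrow> freq n g \<le> max_freq n"
  unfolding max_freq_def by (rule Max_ge) (use finite_range in auto)

lemma density_mean_right_quotient_le:
  "density_mean (right_quotient (\<eta> -` {g}) v) n \<le> max_freq n"
  using right_quotient_fibre[of g v]
proof
  assume "right_quotient (\<eta> -` {g}) v = {}"
  \<comment> \<open>An empty quotient has mean 0, so nonnegativity of \<open>max_freq\<close> is
    enough; the fibre of the empty word provides it.\<close>
  moreover have "0 \<le> freq n (\<eta> [])"
    using density_mean_bounds unfolding freq_def by (metis atLeastAtMost_iff)
  then have "0 \<le> max_freq n"
    using freq_le_max_freq[OF rangeI, of n "[]"] by linarith
  ultimately show ?thesis
    by (simp add: density_mean_def)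
qed (use freq_le_max_freq in \<open>auto simp: freq_def\<close>)

(* A maximum principle: freq is harmonic up to 1/n, so a deficit at h spreads to its translates. *)
lemma deficit_step:
  assumes "n > 0" "h \<in> range \<eta>"
  shows "max_freq n - freq n h \<le> CARD('a) * (max_freq n - freq n (h \<otimes> \<eta> [x]) + 1 / n)"
proof -
  define b where "b y = density_mean (right_quotient (\<eta> -` {h \<otimes> \<eta> [x]}) [y]) n" for y
  have bx: "b x = freq n h"
    using assms by (auto simp: b_def freq_def right_quotient_fibre_mult)
  \<comment> \<open>The summand at \<open>x\<close> is kept exactly, since it belongs to the fibre
    of \<open>h\<close>; every other one is bounded by the maximum. The deficit at \<open>h\<close>
    thus enters the average with weight 1 / CARD('a).\<close>
  have "(\<Sum>y\<in>UNIV. b y) = b x + (\<Sum>y\<in>UNIV - {x}. b y)"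
    by (simp add: sum.remove)
  also have "(\<Sum>y\<in>UNIV - {x}. b y) \<le> (\<Sum>y\<in>UNIV - {x}. max_freq n)"
    unfolding b_def by (rule sum_mono) (rule density_mean_right_quotient_le)
  also have "\<dots> = CARD('a) * max_freq n - max_freq n"
    using zero_less_card_finite[where 'a='a] by (simp add: card_Diff_singleton of_nat_diff algebra_simps)
  finally have "(\<Sum>y\<in>UNIV. b y) \<le> freq n h + CARD('a) * max_freq n - max_freq n"
    by (simp add: bx)
  moreover have "freq n (h \<otimes> \<eta> [x]) \<le> (\<Sum>y\<in>UNIV. b y) / CARD('a) + 1 / n"
    unfolding freq_def b_def by (rule density_mean_right_quotients) fact
  then have "CARD('a) * (freq n (h \<otimes> \<eta> [x]) - 1 / n) \<le> (\<Sum>y\<in>UNIV. b y)"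
    by (simp add: field_simps)
  ultimately show ?thesis by (simp add: algebra_simps)
qed

text \<open>Iterates \<open>deficit_step\<close> along \<open>w\<close>. The constant is chosen
  before \<open>n\<close> and \<open>h\<close>: uniformity in \<open>h\<close> lets the induction
  move on to \<open>h \<otimes> \<eta> [x]\<close>, uniformity in \<open>n\<close> makes the error
  vanish in the limit.\<close>

lemma deficit_word:
  "\<exists>c. \<forall>n>0. \<forall>h\<in>range \<eta>.
    max_freq n - freq n h \<le> CARD('a) ^ length w * (max_freq n - freq n (h \<otimes> \<eta> w)) + c / n"
proof (induction w)
  case Nil
  show ?case by (intro exI[of _ 0]) auto
next
  case (Cons x w)
  then obtain c where c: "\<And>n h. n > 0 \<Longrightarrow> h \<in> range \<eta> \<Longrightarrow>
      max_freq n - freq n h \<le> CARD('a) ^ length w * (max_freq n - freq n (h \<otimes> \<eta> w)) + c / n"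
    by blast
  show ?case
  \<comment> \<open>The error of the tail grows by the new 1 / n, and the sum is multiplied by the
    alphabet size.\<close>
  proof (intro exI[of _ "CARD('a) * (c + 1)"] allI impI ballI)
    fix n :: nat and h assume n: "n > 0" and h: "h \<in> range \<eta>"
    have hx: "h \<otimes> \<eta> [x] \<in> range \<eta>"
      using h by (metis \<eta>_append rangeE rangeI)
    have eq: "h \<otimes> \<eta> [x] \<otimes> \<eta> w = h \<otimes> \<eta> (x # w)"
      using h \<eta>_append[of "[x]" w] by (auto simp: m_assoc)
    have "max_freq n - freq n h \<le> CARD('a) * (max_freq n - freq n (h \<otimes> \<eta> [x]) + 1 / n)"
      by (rule deficit_step[OF n h])
    also have "\<dots> \<le> CARD('a) *
        (CARD('a) ^ length w * (max_freq n - freq n (h \<otimes> \<eta> (x # w))) + c / n + 1 / n)"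
      using c[OF n hx] by (intro mult_left_mono add_right_mono) (simp_all add: eq)
    also have "\<dots> = CARD('a) ^ length (x # w) * (max_freq n - freq n (h \<otimes> \<eta> (x # w)))
        + CARD('a) * (c + 1) / n"
      by (simp add: algebra_simps add_divide_distrib)
    finally show "max_freq n - freq n h \<le> CARD('a) ^ length (x # w) *
        (max_freq n - freq n (h \<otimes> \<eta> (x # w))) + CARD('a) * (c + 1) / n" .
  qed
qed

text \<open>Some word leads from \<open>h\<close> to an element where the maximum is attained. The
  deficit there is 0, so \<open>deficit_word\<close> leaves only its error term.\<close>

lemma deficit_bound:
  assumes h: "h \<in> range \<eta>"
  shows "\<exists>c. \<forall>n>0. max_freq n - freq n h \<le> c / n"
proof -
  obtain v where v: "h = \<eta> v" using h by blast
  have "\<exists>c. \<forall>n>0. freq n g = max_freq n \<longrightarrow> max_freq n - freq n h \<le> c / n" if g: "g \<in> range \<eta>" for g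
  proof -
    obtain u where u: "g = \<eta> u" using g by blast
    \<comment> \<open>The path from \<open>h\<close> to \<open>g\<close> passes through the
      identity: \<open>v'\<close> undoes \<open>v\<close>, then \<open>u\<close> reaches
      \<open>g\<close>.\<close>
    obtain v' where "\<eta> (v @ v') = \<one>"
      using common_inverse_word[OF finite_group_morphism_axioms finite_group_morphism_axioms] by metis
    then have "h \<otimes> \<eta> (v' @ u) = g"
      by (simp add: v u m_assoc[symmetric])
    moreover obtain c where "\<And>n. n > 0 \<Longrightarrow> max_freq n - freq n h \<le>
        CARD('a) ^ length (v' @ u) * (max_freq n - freq n (h \<otimes> \<eta> (v' @ u))) + c / n"
      using deficit_word[of "v' @ u"] h by blast
    ultimately have "max_freq n - freq n h \<le> c / n" if "n > 0" "freq n g = max_freq n" for n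
      using that by (metis add_0 cancel_comm_monoid_add_class.diff_cancel mult_zero_right)
    then show ?thesis by blast
  qed
  then obtain c where c: "\<And>g n. g \<in> range \<eta> \<Longrightarrow> n > 0 \<Longrightarrow> freq n g = max_freq n \<Longrightarrow>
      max_freq n - freq n h \<le> c g / n"
    by metis
  \<comment> \<open>The maximiser may change with \<open>n\<close> but lies in a finite set, so the
    sum of the absolute values of all \<open>c g\<close> serves for every \<open>n\<close>.\<close>
  have "max_freq n - freq n h \<le> (\<Sum>g\<in>range \<eta>. \<bar>c g\<bar>) / n" if n: "n > 0" for n
  proof -
    have "max_freq n \<in> freq n ` range \<eta>"
      unfolding max_freq_def by (rule Max_in) (use finite_range in auto)
    then obtain g where g: "g \<in> range \<eta>" "freq n g = max_freq n" by (metis imageE)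
    have "c g \<le> (\<Sum>g\<in>range \<eta>. \<bar>c g\<bar>)"
      using member_le_sum[OF g(1), of "\<lambda>g. \<bar>c g\<bar>"] finite_range by auto
    then have "c g / n \<le> (\<Sum>g\<in>range \<eta>. \<bar>c g\<bar>) / n"
      by (rule divide_right_mono) simp
    then show ?thesis using c[OF g(1) n g(2)] by linarith
  qed
  then show ?thesis by blast
qed

lemma deficit_tendsto_0:
  assumes "h \<in> range \<eta>"
  shows "(\<lambda>n. max_freq n - freq n h) \<longlonglongrightarrow> 0"
proof -
  obtain c where c: "\<And>n. n > 0 \<Longrightarrow> max_freq n - freq n h \<le> c / n"
    using deficit_bound[OF assms] by blast
  show ?thesis
  proof (rule tendsto_sandwich[of "\<lambda>_. 0" _ _ "\<lambda>n. c / real n"])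
    show "\<forall>\<^sub>F n in sequentially. max_freq n - freq n h \<le> c / real n"
      using eventually_gt_at_top[of 0] by eventually_elim (rule c)
    show "(\<lambda>n. c / real n) \<longlonglongrightarrow> 0" by (rule lim_const_over_n)
  qed (use freq_le_max_freq[OF assms] in auto)
qed

lemma density_mean_vimage: "density_mean (\<eta> -` S) n = (\<Sum>g\<in>S \<inter> range \<eta>. freq n g)"
proof -
  have "\<eta> -` S = (\<Union>g\<in>S \<inter> range \<eta>. \<eta> -` {g})" by auto
  then show ?thesis
    unfolding freq_def
    by (simp only:) (rule density_mean_UN, use finite_range in \<open>auto simp: disjoint_family_on_def\<close>)
qed

text \<open>The fibre means add up to 1 and, as all deficits vanish, become equal in the
  limit.\<close>

lemma freq_tendsto:
  assumes "h \<in> range \<eta>"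
  shows "(\<lambda>n. freq n h) \<longlonglongrightarrow> 1 / card (range \<eta>)"
proof -
  have "(\<lambda>n. \<Sum>g\<in>range \<eta>. max_freq n - freq n g) \<longlonglongrightarrow> (\<Sum>g\<in>range \<eta>. 0)"
    by (intro tendsto_sum deficit_tendsto_0)
  \<comment> \<open>This is \<open>freq n h\<close> rewritten: the total 1 plus all deficits is
    \<open>card (range \<eta>)\<close> times \<open>max_freq n\<close>. The equality is only
    eventual because the total mean at n = 0 is 0.\<close>
  then have "(\<lambda>n. (1 + (\<Sum>g\<in>range \<eta>. max_freq n - freq n g)) / card (range \<eta>)
      - (max_freq n - freq n h)) \<longlonglongrightarrow> (1 + 0) / card (range \<eta>) - 0"
    using finite_range by (intro tendsto_intros deficit_tendsto_0 assms) auto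
  moreover have "\<forall>\<^sub>F n in sequentially. (1 + (\<Sum>g\<in>range \<eta>. max_freq n - freq n g)) / card (range \<eta>)
      - (max_freq n - freq n h) = freq n h"
    using eventually_gt_at_top[of 0]
  proof eventually_elim
    case (elim n)
    have "(\<Sum>g\<in>range \<eta>. freq n g) = 1"
      using density_mean_vimage[of UNIV n] density_mean_UNIV[OF elim, where 'a='a] by simp
    then show ?case
      using finite_range by (simp add: sum_subtractf card_eq_0_iff)
  qed
  ultimately show ?thesis
    using Lim_transform_eventually by fastforce
qed

lemma lang_density_vimage:
  "lang_density (\<eta> -` S) = Some (real (card (S \<inter> range \<eta>)) / real (card (range \<eta>)))"
proof -
  have "(\<lambda>n. density_mean (\<eta> -` S) n) \<longlonglongrightarrow> (\<Sum>g\<in>S \<inter> range \<eta>. 1 / real (card (range \<eta>)))"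
    unfolding density_mean_vimage by (intro tendsto_sum freq_tendsto) simp
  then show ?thesis
    by (auto simp: lang_density_def convergent_def dest: limI)
qed

end

section \<open>Existence and strict positivity of densities\<close>

lemma group_langsE:
  assumes "L \<in> group_langs"
  obtains G :: "nat monoid" and \<eta> S where "finite_group_morphism G \<eta>" "L = \<eta> -` S"
  using assms
  unfolding group_langs_def finite_group_morphism_def finite_group_morphism_axioms_def by blast

lemma group_lang_has_density:
  fixes L :: "'a::finite list set"
  assumes "L \<in> group_langs"
  obtains d where "lang_density L = Some d"
proof -
  obtain G :: "nat monoid" and \<eta> S where "finite_group_morphism G \<eta>" and L: "L = \<eta> -` S"
    using assms by (rule group_langsE)
  then interpret equidistribution G \<eta> by (simp add: equidistribution_def)
  show ?thesis using that lang_density_vimage L by blast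
qed

text \<open>Every element of the image carries the same positive weight, so density 0 leaves no word
  at all. For general regular languages this fails: finite nonempty languages have density
  0.\<close>

lemma group_lang_density_0:
  fixes L :: "'a::finite list set"
  assumes "L \<in> group_langs" "lang_density L = Some 0"
  shows "L = {}"
proof -
  obtain G :: "nat monoid" and \<eta> S where "finite_group_morphism G \<eta>" and L: "L = \<eta> -` S"
    using assms(1) by (rule group_langsE)
  then interpret equidistribution G \<eta> by (simp add: equidistribution_def)
  have "S \<inter> range \<eta> = {}"
    using assms(2) finite_range by (auto simp: L lang_density_vimage card_eq_0_iff)
  then show ?thesis by (auto simp: L)
qed

section \<open>Measures with respect to a local variety\<close>

lemma lang_density_tendsto: "lang_density L = Some d \<Longrightarrow> density_mean L \<longlonglongrightarrow> d"
  by (auto simp: lang_density_def convergent_LIMSEQ_iff split: if_splits)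

lemma lang_density_mono:
  fixes K L :: "'a::finite list set"
  assumes "K \<subseteq> L" "lang_density K = Some d" "lang_density L = Some e"
  shows "d \<le> e"
  using lang_density_tendsto[OF assms(2)] lang_density_tendsto[OF assms(3)]
  by (rule LIMSEQ_le) (use density_mean_mono[OF assms(1)] in auto)

lemma lang_density_Diff:
  fixes K L :: "'a::finite list set"
  assumes "K \<subseteq> L" "lang_density K = Some d" "lang_density L = Some e"
  shows "lang_density (L - K) = Some (e - d)"
proof -
  have "card ((L - K) \<inter> words k) = card (L \<inter> words k) - card (K \<inter> words k)"
    "card (K \<inter> words k) \<le> card (L \<inter> words k)" for k
    using assms(1) card_Diff_subset[of "K \<inter> words k" "L \<inter> words k"]
      card_mono[of "L \<inter> words k" "K \<inter> words k"]
    by (auto simp: words_finite Diff_Int_distrib2)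
  then have "density_mean (L - K) = (\<lambda>n. density_mean L n - density_mean K n)"
    by (simp add: fun_eq_iff density_mean_def of_nat_diff diff_divide_distrib sum_subtractf algebra_simps)
  then have "density_mean (L - K) \<longlonglongrightarrow> e - d"
    using tendsto_diff[OF lang_density_tendsto[OF assms(3)] lang_density_tendsto[OF assms(2)]]
    by simp
  then show ?thesis
    by (auto simp: lang_density_def convergent_def dest: limI)
qed

text \<open>Here and in the next three lemmas, \<open>Sup\<close> and \<open>Inf\<close> need
  bounded nonempty sets: densities lie between 0 and 1, and \<open>{}\<close> or \<open>UNIV\<close>
  in \<open>C\<close> supplies an element where nonemptiness is at stake.\<close>

lemma lower_measure_ge:
  fixes L :: "'a::finite list set"
  assumes "K \<in> C" "K \<subseteq> L" "lang_density K = Some d"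
  shows "d \<le> lower_measure C L"
  unfolding lower_measure_def
  by (rule cSup_upper) (use assms lang_density_bounds in \<open>auto intro!: bdd_aboveI[of _ 1]\<close>)

lemma lower_measure_le:
  fixes L :: "'a::finite list set"
  assumes "{} \<in> C" "\<And>K d. K \<in> C \<Longrightarrow> K \<subseteq> L \<Longrightarrow> lang_density K = Some d \<Longrightarrow> d \<le> b"
  shows "lower_measure C L \<le> b"
  unfolding lower_measure_def
  by (rule cSup_least) (use assms lang_density_empty in blast)+

lemma upper_measure_le:
  fixes L :: "'a::finite list set"
  assumes "K \<in> C" "L \<subseteq> K" "lang_density K = Some d"
  shows "upper_measure C L \<le> d"
  unfolding upper_measure_def
  by (rule cInf_lower) (use assms lang_density_bounds in \<open>auto intro!: bdd_belowI[of _ 0]\<close>)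

lemma upper_measure_ge:
  fixes L :: "'a::finite list set"
  assumes "UNIV \<in> C" "\<And>K d. K \<in> C \<Longrightarrow> L \<subseteq> K \<Longrightarrow> lang_density K = Some d \<Longrightarrow> b \<le> d"
  shows "b \<le> upper_measure C L"
  unfolding upper_measure_def
  by (rule cInf_greatest) (use assms lang_density_UNIV in blast)+

lemma lower_le_upper_measure:
  fixes L :: "'a::finite list set"
  assumes "{} \<in> C" "UNIV \<in> C"
  shows "lower_measure C L \<le> upper_measure C L"
proof (rule upper_measure_ge[OF assms(2)])
  fix K d assume K: "L \<subseteq> K" "lang_density K = Some d"
  show "lower_measure C L \<le> d"
  proof (rule lower_measure_le[OF assms(1)])
    fix K' e assume "K' \<subseteq> L" "lang_density K' = Some e"
    then show "e \<le> d" using K lang_density_mono[of K' K e d] by auto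
  qed
qed

text \<open>A larger family can only raise the lower measure and reduce the upper one, and the two
  cannot cross, so an equality persists.\<close>

lemma lang_measurable_mono:
  fixes L :: "'a::finite list set"
  assumes "{} \<in> C" "UNIV \<in> C" "C \<subseteq> D" "lang_measurable C L"
  shows "lang_measurable D L"
proof -
  have "lower_measure C L \<le> lower_measure D L"
    by (intro lower_measure_le[OF assms(1)] lower_measure_ge) (use assms(3) in auto)
  moreover have "upper_measure D L \<le> upper_measure C L"
    by (intro upper_measure_ge[OF assms(2)] upper_measure_le) (use assms(3) in auto)
  moreover have "lower_measure D L \<le> upper_measure D L"
    by (rule lower_le_upper_measure) (use assms in auto)
  ultimately show ?thesis
    using assms(4) by (simp add: lang_measurable_def)
qed

lemma lang_measurable_member:
  fixes L :: "'a::finite list set"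
  assumes "{} \<in> C" "UNIV \<in> C" "L \<in> C" "lang_density L = Some d"
  shows "lang_measurable C L"
  using lower_measure_ge[OF assms(3) order.refl assms(4)]
    upper_measure_le[OF assms(3) order.refl assms(4)] lower_le_upper_measure[OF assms(1,2), of L]
  by (simp add: lang_measurable_def)

section \<open>Local varieties and their measurable extensions\<close>

lemma
  assumes "local_variety C"
  shows local_variety_empty: "{} \<in> C" and local_variety_UNIV: "UNIV \<in> C"
    and local_variety_Un: "\<And>K L. K \<in> C \<Longrightarrow> L \<in> C \<Longrightarrow> K \<union> L \<in> C"
    and local_variety_Int: "\<And>K L. K \<in> C \<Longrightarrow> L \<in> C \<Longrightarrow> K \<inter> L \<in> C"
    and local_variety_Compl: "\<And>L. L \<in> C \<Longrightarrow> - L \<in> C"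
    and local_variety_left_quotient: "\<And>L u. L \<in> C \<Longrightarrow> left_quotient u L \<in> C"
  using assms unfolding local_variety_def by blast+

lemma local_variety_Union:
  assumes "local_variety C" "finite F" "F \<subseteq> C"
  shows "\<Union>F \<in> C"
  using assms(2,3)
  by (induction F rule: finite_induct)
    (auto intro: local_variety_empty local_variety_Un assms(1))

lemma RExt_mono:
  fixes C D :: "'a::finite list set set"
  assumes "local_variety C" "C \<subseteq> D"
  shows "RExt C \<subseteq> RExt D"
  using assms lang_measurable_mono by (auto simp: RExt_def local_variety_def)

lemma local_variety_subset_RExt:
  fixes C :: "'a::finite list set set"
  assumes "local_variety C" "C \<subseteq> group_langs"
  shows "C \<subseteq> RExt C"
proof
  fix L assume L: "L \<in> C"
  then obtain d where "lang_density L = Some d"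
    using assms(2) group_lang_has_density by blast
  then have "lang_measurable C L"
    using assms(1) L by (intro lang_measurable_member) (auto simp: local_variety_def)
  then show "L \<in> RExt C"
    using assms(1) L by (simp add: RExt_def local_variety_def)
qed

section \<open>Largest subsets and smallest supersets\<close>

text \<open>Replaces an arbitrary \<open>K\<close> by a language determined by a subset of the
  finite carrier, so that finitely many candidates suffice later.\<close>

lemma (in finite_group_morphism) saturated_between:
  assumes C: "local_variety C" "C \<subseteq> group_langs" and K: "K \<in> C" "K \<subseteq> \<eta> -` S"
  obtains T where "T \<subseteq> carrier G" "\<eta> -` T \<in> C" "K \<subseteq> \<eta> -` T" "\<eta> -` T \<subseteq> \<eta> -` S"
proof -
  obtain H :: "nat monoid" and \<phi> R where H: "finite_group_morphism H \<phi>" and KR: "K = \<phi> -` R"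
    using K(1) C(2) group_langsE by blast
  interpret H: finite_group_morphism H \<phi> by fact
  define Q where "Q = (\<lambda>u. left_quotient u K) ` {u. \<eta> u = \<one>}"
  have mem: "w \<in> \<Union>Q \<longleftrightarrow> (\<exists>u. \<eta> u = \<one> \<and> u @ w \<in> K)" for w
    by (auto simp: Q_def left_quotient_def)
  \<comment> \<open>The kernel of \<eta> is infinite, but the quotient of \<open>K\<close> by
    \<open>u\<close> depends only on \<open>\<phi> u\<close>; hence a finite union suffices.\<close>
  have "Q \<subseteq> (\<lambda>h. {w. h \<otimes>\<^bsub>H\<^esub> \<phi> w \<in> R}) ` range \<phi>"
    by (auto simp: Q_def left_quotient_def KR)
  then have "finite Q"
    using H.finite_range finite_subset by blast
  moreover have "Q \<subseteq> C"
    using local_variety_left_quotient[OF C(1) K(1)] by (auto simp: Q_def)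
  ultimately have QC: "\<Union>Q \<in> C"
    using C(1) local_variety_Union by blast
  have sat: "w' \<in> \<Union>Q" if "w \<in> \<Union>Q" and eq: "\<eta> w = \<eta> w'" for w w'
  proof -
    obtain u where u: "\<eta> u = \<one>" "u @ w \<in> K" using \<open>w \<in> \<Union>Q\<close> mem by blast
    \<comment> \<open>The prefix \<open>u @ w @ v\<close> of \<open>w'\<close> looks different to
      the two morphisms: \<eta> sees \<open>w @ v\<close> as \<open>w' @ v\<close>, so the prefix is
      in its kernel, whereas \<phi> cancels \<open>v @ w'\<close> and sees only
      \<open>u @ w\<close>, so membership in \<open>K\<close> carries over.\<close>
    obtain v where v: "\<eta> (w' @ v) = \<one>" "\<phi> (v @ w') = \<one>\<^bsub>H\<^esub>"
      using common_inverse_word[OF finite_group_morphism_axioms H] by metis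
    have "\<eta> (u @ w @ v) = \<one>"
      using u(1) v(1) eq by simp
    moreover have "\<phi> ((u @ w @ v) @ w') = \<phi> (u @ w)"
      using v(2) by (simp add: H.m_assoc)
    then have "(u @ w @ v) @ w' \<in> K"
      using u(2) by (simp add: KR)
    ultimately show ?thesis
      using mem by blast
  qed
  have vim: "\<eta> -` (\<eta> ` \<Union>Q) = \<Union>Q"
  proof (intro subset_antisym subsetI)
    fix w assume "w \<in> \<eta> -` (\<eta> ` \<Union>Q)"
    then obtain w' where "w' \<in> \<Union>Q" "\<eta> w' = \<eta> w" by (metis imageE vimageE)
    then show "w \<in> \<Union>Q" by (rule sat)
  qed (rule vimageI2, rule imageI)
  show thesis
  proof (rule that[of "\<eta> ` \<Union>Q"])
    \<comment> \<open>The empty word is in the kernel, and the quotient by it is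
      \<open>K\<close>.\<close>
    show "K \<subseteq> \<eta> -` (\<eta> ` \<Union>Q)"
      unfolding vim using mem \<eta>_Nil by (metis append_Nil subsetI)
    \<comment> \<open>A prefix in the kernel does not change the value of \<eta>, so
      \<open>u @ w\<close> in \<open>K\<close> already puts the value of \<open>w\<close> in
      \<open>S\<close>.\<close>
    show "\<eta> -` (\<eta> ` \<Union>Q) \<subseteq> \<eta> -` S"
    proof
      fix w assume "w \<in> \<eta> -` (\<eta> ` \<Union>Q)"
      then obtain u where "\<eta> u = \<one>" "\<eta> (u @ w) \<in> S"
        unfolding vim using mem K(2) by blast
      then show "w \<in> \<eta> -` S" by simp
    qed
  qed (use vim QC in auto)
qed

text \<open>\<open>C\<close> is closed under finite unions only, so the union of all its members
  below \<open>L\<close> is not directly available. By \<open>saturated_between\<close> each of them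
  lies below a saturated one, and the finite carrier allows only finitely many of those.\<close>

lemma largest_subset:
  assumes C: "local_variety C" "C \<subseteq> group_langs" and "L \<in> group_langs"
  obtains M where "M \<in> C" "M \<subseteq> L" "\<And>K. K \<in> C \<Longrightarrow> K \<subseteq> L \<Longrightarrow> K \<subseteq> M"
proof -
  obtain G :: "nat monoid" and \<eta> S where G: "finite_group_morphism G \<eta>" and L: "L = \<eta> -` S"
    using assms(3) by (rule group_langsE)
  interpret finite_group_morphism G \<eta> by fact
  define F where "F = {K \<in> (\<lambda>T. \<eta> -` T) ` Pow (carrier G). K \<in> C \<and> K \<subseteq> L}"
  have "finite F" by (simp add: F_def finite_carrier)
  moreover have "F \<subseteq> C" by (auto simp: F_def)
  ultimately have "\<Union>F \<in> C"
    using C(1) local_variety_Union by blast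
  moreover have "\<Union>F \<subseteq> L" by (auto simp: F_def)
  moreover have "K \<subseteq> \<Union>F" if K: "K \<in> C" "K \<subseteq> L" for K
  proof -
    obtain T where "T \<subseteq> carrier G" "\<eta> -` T \<in> C" "K \<subseteq> \<eta> -` T" "\<eta> -` T \<subseteq> L"
      using saturated_between[OF C K(1)] K(2) unfolding L by metis
    then have "\<eta> -` T \<in> F" by (auto simp: F_def)
    then show ?thesis using \<open>K \<subseteq> \<eta> -` T\<close> by blast
  qed
  ultimately show thesis by (rule that)
qed

lemma Compl_group_lang:
  assumes "L \<in> group_langs"
  shows "- L \<in> group_langs"
proof -
  obtain G :: "nat monoid" and \<eta> S where "finite_group_morphism G \<eta>" and L: "L = \<eta> -` S"
    using assms by (rule group_langsE)
  then interpret finite_group_morphism G \<eta> by simp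
  have "\<eta> -` (carrier G - S) \<in> group_langs"
    by (rule group_langsI) (use finite_carrier morphism is_group in auto)
  moreover have "\<eta> -` (carrier G - S) = - L" by (auto simp: L)
  ultimately show ?thesis by simp
qed

text \<open>Complementation, under which \<open>C\<close> and the group languages are closed,
  exchanges this with \<open>largest_subset\<close>.\<close>

lemma smallest_superset:
  assumes C: "local_variety C" "C \<subseteq> group_langs" and "L \<in> group_langs"
  obtains M where "M \<in> C" "L \<subseteq> M" "\<And>K. K \<in> C \<Longrightarrow> L \<subseteq> K \<Longrightarrow> M \<subseteq> K"
proof -
  note Compl = local_variety_Compl[OF C(1)]
  obtain N where N: "N \<in> C" "N \<subseteq> - L" "\<And>K. K \<in> C \<Longrightarrow> K \<subseteq> - L \<Longrightarrow> K \<subseteq> N"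
    using largest_subset[OF C Compl_group_lang[OF assms(3)]] by blast
  show thesis
  proof (rule that[of "- N"])
    fix K assume "K \<in> C" "L \<subseteq> K"
    then show "- N \<subseteq> K" using N(3)[OF Compl] by blast
  qed (use N Compl in auto)
qed

text \<open>The extremal \<open>M\<close> and \<open>N\<close> attain the two measures, so
  measurability becomes an equality of two densities.\<close>

lemma measurable_group_lang_member:
  fixes C :: "'a::finite list set set"
  assumes C: "local_variety C" "C \<subseteq> group_langs"
    and L: "L \<in> group_langs" "lang_measurable C L"
  shows "L \<in> C"
proof -
  obtain M where M: "M \<in> C" "M \<subseteq> L" "\<And>K. K \<in> C \<Longrightarrow> K \<subseteq> L \<Longrightarrow> K \<subseteq> M"
    using largest_subset[OF C L(1)] by blast
  obtain N where N: "N \<in> C" "L \<subseteq> N" "\<And>K. K \<in> C \<Longrightarrow> L \<subseteq> K \<Longrightarrow> N \<subseteq> K"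
    using smallest_superset[OF C L(1)] by blast
  obtain d where d: "lang_density M = Some d"
    using group_lang_has_density[OF subsetD[OF C(2) M(1)]] .
  obtain e where e: "lang_density N = Some e"
    using group_lang_has_density[OF subsetD[OF C(2) N(1)]] .
  note bounds = local_variety_empty[OF C(1)] local_variety_UNIV[OF C(1)]
  \<comment> \<open>Every competitor in the infimum contains \<open>N\<close>, so its density is at
    least \<open>e\<close>; the bound by \<open>d\<close> below is dual.\<close>
  have "e \<le> upper_measure C L"
    by (intro upper_measure_ge bounds) (rule lang_density_mono[OF N(3) e])
  also have "\<dots> = lower_measure C L"
    using L(2) by (simp add: lang_measurable_def)
  also have "\<dots> \<le> d"
    by (intro lower_measure_le bounds) (rule lang_density_mono[OF M(3) _ d])
  finally have "e \<le> d" .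
  moreover have MN: "M \<subseteq> N" using M(2) N(2) by (rule order.trans)
  then have "d \<le> e" using d e by (rule lang_density_mono)
  ultimately have "lang_density (N - M) = Some 0"
    using lang_density_Diff[OF MN d e] by simp
  \<comment> \<open>As a member of \<open>C\<close> the difference is itself a group language, so
    density 0 makes it empty.\<close>
  moreover have "N - M \<in> C"
    unfolding Diff_eq using C(1) M(1) N(1) by (intro local_variety_Int local_variety_Compl)
  ultimately have "N - M = {}"
    using group_lang_density_0[OF subsetD[OF C(2)]] by blast
  then have "L = M" using M(2) N(2) by blast
  with M(1) show ?thesis by (simp only:)
qed

lemma RExt_Int_group_langs:
  fixes C :: "'a::finite list set set"
  assumes "local_variety C" "C \<subseteq> group_langs"
  shows "RExt C \<inter> group_langs = C"
proof
  show "RExt C \<inter> group_langs \<subseteq> C"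
    unfolding RExt_def using measurable_group_lang_member[OF assms] by blast
  show "C \<subseteq> RExt C \<inter> group_langs"
    using local_variety_subset_RExt[OF assms] assms(2) by (rule Int_greatest)
qed

theorem theorem20:
  fixes C :: "'a::finite list set set"
  assumes "CARD('a) \<ge> 2"
    and "local_variety C"
    and "C \<subseteq> group_langs"
  shows "RExt C \<inter> group_langs = C \<and>
    (\<forall>D. local_variety D \<and> C \<subset> D \<and> D \<subseteq> group_langs \<longrightarrow>
       RExt C \<inter> D = C \<and> \<not> D \<subseteq> RExt C \<and> RExt C \<subset> RExt D)"
proof (intro conjI allI impI)
  show main: "RExt C \<inter> group_langs = C"
    using assms(2,3) by (rule RExt_Int_group_langs)
  fix D :: "'a list set set"
  assume D: "local_variety D \<and> C \<subset> D \<and> D \<subseteq> group_langs"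
  show "RExt C \<inter> D = C" using main D by blast
  \<comment> \<open>Otherwise the intersection just computed would be all of \<open>D\<close>,
    forcing \<open>D\<close> = \<open>C\<close>.\<close>
  then show not_sub: "\<not> D \<subseteq> RExt C" using D by blast
  show "RExt C \<subset> RExt D"
    \<comment> \<open>Strictness comes from \<open>D\<close> itself, which lies inside
      \<open>RExt D\<close> but not inside \<open>RExt C\<close>.\<close>
    using RExt_mono[OF assms(2), of D] local_variety_subset_RExt[of D] D not_sub by blast
qed

end
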